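(* Let $n\ge 1$ and let $f^1,\ldots,f^n:[0,1]^2\to\mathbb{R}$ be positive and monotone functions, where $[0,1]^2$ carries Lebesgue measure. Then $E_n(f^1,\ldots,f^n)\ge 0$.
   Context: "Positive" means non-negative. $[0,1]^2$ is partially ordered by $x\le x'$ iff $x_i\le x_i'$ for $i=1,2$, and $f$ is monotone (decreasing) if $x\le x'$ implies $f(x)\ge f(x')$. Write $\mathcal{E}(f)=\int f$ for the integral with respect to Lebesgue measure. For $\sigma$ in the symmetric group $S_n$ with disjoint cycle decomposition $\sigma=(i_1,\ldots,i_p)(j_1,\ldots,j_q)\cdots$ (fixed points included as cycles of length 1), let $C_\sigma$ be the number of cycles and $$E_\sigma(f^1,\ldots,f^n)=\mathcal{E}(f^{i_1}\cdots f^{i_p})\,\mathcal{E}(f^{j_1}\cdots f^{j_q})\cdots .$$ Then $E_n(f^1,\ldots,f^n)=\sum_{\sigma\in S_n}(-1)^{C_\sigma-1}E_\sigma(f^1,\ldots,f^n)$. *)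

theory Defs
  imports "HOL-Analysis.Analysis" "HOL-Combinatorics.Orbits"
begin

text \<open>
  The order on \<^typ>\<open>real^2\<close> is the componentwise one, so \<^term>\<open>{0..1} :: (real^2) set\<close> is
  the closed unit square.  The integral uses the completed measure, because a monotone
  function on the square is Lebesgue measurable but need not be Borel measurable.
\<close>

definition square_integral :: "(real^2 \<Rightarrow> real) \<Rightarrow> real" where
  "square_integral g = (LINT x|lebesgue_on {0..1}. g x)"

text \<open>
  A cycle of \<open>\<sigma>\<close>, a permutation of \<open>{1..n}\<close>, is represented by its underlying set, an orbit;
  a fixed point \<open>i\<close> gives the orbit \<open>{i}\<close>.
\<close>

definition cycle_sets :: "nat \<Rightarrow> (nat \<Rightarrow> nat) \<Rightarrow> nat set set" where
  "cycle_sets n \<sigma> = orbit \<sigma> ` {1..n}"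

definition num_cycles :: "nat \<Rightarrow> (nat \<Rightarrow> nat) \<Rightarrow> nat" where
  "num_cycles n \<sigma> = card (cycle_sets n \<sigma>)"

definition E_perm :: "nat \<Rightarrow> (nat \<Rightarrow> nat) \<Rightarrow> (nat \<Rightarrow> real^2 \<Rightarrow> real) \<Rightarrow> real" where
  "E_perm n \<sigma> f = (\<Prod>c\<in>cycle_sets n \<sigma>. square_integral (\<lambda>x. \<Prod>i\<in>c. f i x))"

text \<open>For \<open>n \<ge> 1\<close> there is at least one cycle, so the subtraction in the exponent is exact.\<close>

definition E_corr :: "nat \<Rightarrow> (nat \<Rightarrow> real^2 \<Rightarrow> real) \<Rightarrow> real" where
  "E_corr n f = (\<Sum>\<sigma> | \<sigma> permutes {1..n}. (- 1) ^ (num_cycles n \<sigma> - 1) * E_perm n \<sigma> f)"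

end

theory Submission
  imports Defs
begin

text \<open>
  Write \<open>W\<close> for \<open>- E\<^sub>n\<close>, the sum over all permutations of the product over the cycles \<open>c\<close> of minus the integral of
  \<open>\<Prod>i\<in>c. f i\<close>.  We show \<open>W \<le> 0\<close>.  Products of non-negative decreasing functions are again non-negative and decreasing, and
  the integral of such a function is the limit of its means over \<open>N \<times> N\<close> grids
  (\<open>riemann_sums_tendsto_square_integral\<close>).  So it suffices to prove \<open>W \<le> 0\<close> for the mean over a finite
  grid.  There \<open>W\<close> is linear in each function, and a non-negative decreasing function is a non-negative
  combination of indicators of down-closed sets, called staircases here
  (\<open>signed_cycle_sum_layer_cake\<close>).  What remains is a statement about finitely many staircases \<open>D i\<close>,
  proved by induction on their number (\<open>signed_cycle_sum_staircases_nonpos\<close>).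

  As a function of one staircase \<open>D i\<close>, with the others fixed, \<open>W\<close> is the sum of contributions of the points of
  \<open>D i\<close>.  By the recursion \<open>signed_cycle_sum_insert\<close>, the contribution of \<open>p\<close> depends only on which of the
  other staircases contain \<open>p\<close>, and by the induction hypothesis it is \<open>\<ge> 0\<close> unless all of them do
  (\<open>signed_cycle_sum_point_cong\<close>, \<open>signed_cycle_sum_point_nonneg\<close>).  Consider a family that maximizes
  \<open>W\<close>, chosen with as many points as possible.  If some \<open>D i\<close> is the whole grid, then \<open>W\<close> is a
  non-negative multiple of the sum for the remaining staircases, or zero, and the induction hypothesis applies.
  Otherwise no point with non-negative contribution can be added, so each minimal
  point of the complement of one staircase lies in all others.  This forces the others to look the same on the
  two columns that meet at such a corner, in the rows where these columns differ for the given staircase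
  (\<open>gap_columns_agree\<close>); hence the corner can be moved left or right with
  opposite effects on \<open>W\<close>, and one of the two moves contradicts the choice of the family.  Only corners in the
  first column escape this, and two staircases cannot both have such a corner.
\<close>

section \<open>Signed cycle sums\<close>

text \<open>
  For \<open>a \<notin> S\<close>, every permutation of \<open>insert a S\<close> is \<open>transpose a b \<circ> q\<close> for a permutation \<open>q\<close> of \<open>S\<close>
  and \<open>b \<in> insert a S\<close>.  If \<open>b \<in> S\<close>, then the point that \<open>q\<close> sends to \<open>b\<close> is now sent to \<open>a\<close>, and \<open>a\<close> is
  sent to \<open>b\<close>: the new element is spliced into the cycle of \<open>b\<close>, just in front of \<open>b\<close>.  All other cycles
  are untouched.
\<close>

lemma orbit_transpose_comp_same:
  assumes "q permutes S" "finite S" "a \<notin> S" "b \<in> S" "x \<in> S" "b \<notin> orbit q x"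
  shows "orbit (Transposition.transpose a b \<circ> q) x = orbit q x"
proof (rule orbit_cong)
  have "permutation q"
    using assms permutation_permutes by blast
  then show "x \<in> orbit q x"
    by (rule permutation_self_in_orbit)
  have sub: "orbit q x \<subseteq> S"
    by (rule permutes_orbit_subset) (use assms in auto)
  fix y assume y: "y \<in> orbit q x"
  then have "q y \<in> orbit q x"
    by (rule orbit.step)
  then show "(Transposition.transpose a b \<circ> q) y = q y"
    using sub assms by (auto simp: Transposition.transpose_def)
qed

lemma orbit_transpose_comp_insert:
  assumes "q permutes S" "finite S" "a \<notin> S" "b \<in> S" "x \<in> S" "b \<in> orbit q x"
  shows "orbit (Transposition.transpose a b \<circ> q) x = insert a (orbit q x)"
proof -
  let ?p = "Transposition.transpose a b \<circ> q"
  have "permutation q"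
    using assms permutation_permutes by blast
  then have self: "x \<in> orbit q x"
    by (rule permutation_self_in_orbit)
  have sub: "orbit q x \<subseteq> S"
    by (rule permutes_orbit_subset) (use assms in auto)
  have qa: "q a = a"
    using assms by (simp add: permutes_not_in)
  have pa: "?p a = b"
    by (simp add: qa)
  have pb: "?p y = a" if "q y = b" for y
    using that by simp
  have pn: "?p y = q y" if "q y \<noteq> b" "y \<in> S" for y
    using that assms permutes_in_image[of q S y] by (auto simp: Transposition.transpose_def)
  have closed: "?p y \<in> insert a (orbit q x)" if "y \<in> insert a (orbit q x)" for y
  proof (cases "y = a")
    case True
    then show ?thesis
      using pa assms by simp
  next
    case False
    then have "y \<in> orbit q x"
      using that by simp
    then have "q y \<in> orbit q x" "y \<in> S"
      using sub orbit.step by auto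
    then show ?thesis
      using pb pn by (cases "q y = b") auto
  qed
  have "orbit ?p x \<subseteq> insert a (orbit q x)"
  proof
    fix y assume "y \<in> orbit ?p x"
    then show "y \<in> insert a (orbit q x)"
      by (induction rule: orbit.induct) (use closed self in blast)+
  qed
  have mem: "q y \<in> orbit ?p x" if "y \<in> S" "y = x \<or> y \<in> orbit ?p x" for y
  proof (cases "q y = b")
    case True
    have "?p y \<in> orbit ?p x"
      using that(2) orbit.base orbit.step by metis
    then have "a \<in> orbit ?p x"
      using pb[OF True] by simp
    then show ?thesis
      using orbit.step[of a ?p x] pa True by simp
  next
    case False
    have "?p y \<in> orbit ?p x"
      using that(2) orbit.base orbit.step by metis
    then show ?thesis
      using pn[OF False] that by simp
  qed
  have sup: "y \<in> orbit ?p x" if "y \<in> orbit q x" for y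
    using that
  proof (induction rule: orbit.induct)
    case base
    then show ?case using mem assms by blast
  next
    case (step y)
    then show ?case using mem sub by blast
  qed
  have "a \<in> orbit ?p x"
  proof -
    have "\<exists>y. (y = x \<or> y \<in> orbit q x) \<and> b = q y"
      using assms(6) by (cases rule: orbit.cases) auto
    then obtain y where y: "y = x \<or> y \<in> orbit q x" "b = q y"
      by blast
    then have "?p y = a"
      using pb by simp
    moreover have "?p y \<in> orbit ?p x"
      using y sup orbit.base orbit.step by metis
    ultimately show ?thesis
      by simp
  qed
  with sup \<open>orbit ?p x \<subseteq> insert a (orbit q x)\<close> show ?thesis
    by blast
qed

lemma orbits_transpose_comp:
  assumes "q permutes S" "finite S" "a \<notin> S" "b \<in> S"
  shows "orbit (Transposition.transpose a b \<circ> q) ` insert a S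
    = (\<lambda>c. if b \<in> c then insert a c else c) ` (orbit q ` S)"
proof -
  let ?p = "Transposition.transpose a b \<circ> q"
  have "permutation q"
    using assms permutation_permutes by blast
  then have "b \<in> orbit q b"
    by (rule permutation_self_in_orbit)
  then have "a \<in> orbit ?p b"
    using orbit_transpose_comp_insert[OF assms \<open>b \<in> S\<close>] by simp
  moreover have "?p permutes insert a S"
    using assms by (intro permutes_compose permutes_swap_id) (auto intro: permutes_subset)
  then have "cyclic_on ?p (orbit ?p b)"
    using assms by (intro cyclic_on_orbit[where S = "insert a S"]) auto
  ultimately have "orbit ?p a = orbit ?p b"
    using orbit_cyclic_eq3 by metis
  then have "orbit ?p ` insert a S = orbit ?p ` S"
    using \<open>b \<in> S\<close> by auto
  also have "\<dots> = (\<lambda>x. if b \<in> orbit q x then insert a (orbit q x) else orbit q x) ` S"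
    using orbit_transpose_comp_insert[OF assms] orbit_transpose_comp_same[OF assms]
    by (intro image_cong) auto
  also have "\<dots> = (\<lambda>c. if b \<in> c then insert a c else c) ` (orbit q ` S)"
    unfolding image_image ..
  finally show ?thesis .
qed

text \<open>
  With the integral for \<open>I\<close> and \<open>S = {1..n}\<close> this is \<open>- E\<^sub>n\<close>: the sign \<open>(-1)\<close> to the power of the number
  of cycles is distributed over the cycles.  The functional and the index set are kept arbitrary because
  the argument runs over discrete means and over subsets of the indices.
\<close>

definition signed_cycle_sum :: "(('z \<Rightarrow> real) \<Rightarrow> real) \<Rightarrow> 'i set \<Rightarrow> ('i \<Rightarrow> 'z \<Rightarrow> real) \<Rightarrow> real" where
  "signed_cycle_sum I S f
    = (\<Sum>\<sigma> | \<sigma> permutes S. \<Prod>c\<in>orbit \<sigma> ` S. - I (\<lambda>z. \<Prod>i\<in>c. f i z))"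

lemma signed_cycle_sum_empty [simp]: "signed_cycle_sum I {} f = 1"
  by (simp add: signed_cycle_sum_def)

lemma signed_cycle_sum_cong:
  assumes "finite S" "\<And>i. i \<in> S \<Longrightarrow> f i = g i"
  shows "signed_cycle_sum I S f = signed_cycle_sum I S g"
  unfolding signed_cycle_sum_def
proof (intro sum.cong prod.cong refl)
  fix \<sigma> c assume "\<sigma> \<in> {\<sigma>. \<sigma> permutes S}" "c \<in> orbit \<sigma> ` S"
  then have "c \<subseteq> S"
    using permutes_orbit_subset by fastforce
  then have "(\<lambda>z. \<Prod>i\<in>c. f i z) = (\<lambda>z. \<Prod>i\<in>c. g i z)"
    using assms(2) by (intro ext prod.cong) auto
  then show "- I (\<lambda>z. \<Prod>i\<in>c. f i z) = - I (\<lambda>z. \<Prod>i\<in>c. g i z)"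
    by simp
qed

text \<open>
  The recursion on which everything rests: the new index \<open>a\<close> either joins an existing cycle in front of
  one of its elements \<open>b\<close>, which multiplies \<open>f b\<close> by \<open>f a\<close> and preserves the number of cycles, or it forms
  a cycle of its own, which contributes the factor \<open>- I (f a)\<close>.
\<close>

lemma signed_cycle_sum_insert:
  assumes "finite S" "a \<notin> S"
  shows "signed_cycle_sum I (insert a S) f
    = (\<Sum>b\<in>S. signed_cycle_sum I S (f(b := \<lambda>z. f a z * f b z))) - I (f a) * signed_cycle_sum I S f"
proof -
  let ?F = "\<lambda>f S \<sigma>. \<Prod>c\<in>orbit \<sigma> ` S. - I (\<lambda>z. \<Prod>i\<in>c. f i z)"
  have new: "?F f (insert a S) (Transposition.transpose a a \<circ> q) = - I (f a) * ?F f S q" if q: "q permutes S" for q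
  proof -
    have "q a = a"
      using q assms by (simp add: permutes_not_in)
    then have "orbit q a = {a}"
      by (simp add: orbit_eq_singleton_iff)
    moreover have "{a} \<notin> orbit q ` S"
      using permutes_orbit_subset[OF q] assms by blast
    ultimately show ?thesis
      using assms by simp
  qed
  have old: "?F f (insert a S) (Transposition.transpose a b \<circ> q) = ?F (f(b := \<lambda>z. f a z * f b z)) S q"
    if q: "q permutes S" and b: "b \<in> S" for q b
  proof -
    let ?h = "\<lambda>c. if b \<in> c then insert a c else c"
    let ?f = "f(b := \<lambda>z. f a z * f b z)"
    have sub: "c \<subseteq> S" if "c \<in> orbit q ` S" for c
      using permutes_orbit_subset[OF q] that by blast
    \<comment> \<open>Removing \<open>a\<close> undoes the splicing, so distinct cycles stay distinct.\<close>
    have "inj_on ?h (orbit q ` S)"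
      by (rule inj_on_inverseI[where g = "\<lambda>c. c - {a}"]) (use sub assms in auto)
    then have "?F f (insert a S) (Transposition.transpose a b \<circ> q) = (\<Prod>c\<in>orbit q ` S. - I (\<lambda>z. \<Prod>i\<in>?h c. f i z))"
      unfolding orbits_transpose_comp[OF q assms b] by (subst prod.reindex) (auto simp: o_def)
    also have "\<dots> = ?F ?f S q"
    proof (rule prod.cong[OF refl])
      fix c assume "c \<in> orbit q ` S"
      then have c: "c \<subseteq> S" "finite c" "a \<notin> c"
        using sub[of c] assms finite_subset by auto
      have "(\<Prod>i\<in>?h c. f i z) = (\<Prod>i\<in>c. ?f i z)" for z
      proof (cases "b \<in> c")
        case True
        have "(\<Prod>i\<in>c. ?f i z) = ?f b z * (\<Prod>i\<in>c - {b}. ?f i z)"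
          using True c by (intro prod.remove) auto
        also have "(\<Prod>i\<in>c - {b}. ?f i z) = (\<Prod>i\<in>c - {b}. f i z)"
          by (intro prod.cong) auto
        also have "?f b z * (\<Prod>i\<in>c - {b}. f i z) = f a z * (\<Prod>i\<in>c. f i z)"
          using True c by (simp add: prod.remove)
        finally show ?thesis
          using True c by simp
      next
        case False
        then show ?thesis
          by (auto intro!: prod.cong)
      qed
      then show "- I (\<lambda>z. \<Prod>i\<in>?h c. f i z) = - I (\<lambda>z. \<Prod>i\<in>c. ?f i z)"
        by presburger
    qed
    finally show ?thesis .
  qed
  have "signed_cycle_sum I (insert a S) f
    = (\<Sum>b\<in>insert a S. \<Sum>q | q permutes S. ?F f (insert a S) (Transposition.transpose a b \<circ> q))"
    unfolding signed_cycle_sum_def by (rule sum_over_permutations_insert[OF assms])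
  also have "\<dots> = (\<Sum>q | q permutes S. ?F f (insert a S) (Transposition.transpose a a \<circ> q))
      + (\<Sum>b\<in>S. \<Sum>q | q permutes S. ?F f (insert a S) (Transposition.transpose a b \<circ> q))"
    using assms by simp
  also have "(\<Sum>q | q permutes S. ?F f (insert a S) (Transposition.transpose a a \<circ> q)) = - I (f a) * signed_cycle_sum I S f"
    unfolding signed_cycle_sum_def sum_distrib_left
    by (intro sum.cong refl) (use new in blast)
  also have "(\<Sum>b\<in>S. \<Sum>q | q permutes S. ?F f (insert a S) (Transposition.transpose a b \<circ> q))
      = (\<Sum>b\<in>S. signed_cycle_sum I S (f(b := \<lambda>z. f a z * f b z)))"
    unfolding signed_cycle_sum_def
    by (intro sum.cong refl) (use old in blast)
  finally show ?thesis
    by simp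
qed

section \<open>The contribution of a single point\<close>

text \<open>
  Linearity is required on all functions.  Means over finite grids satisfy this; the Lebesgue integral does not,
  since it sends non-integrable functions to \<open>0\<close>.  This is one reason for passing to grids.
\<close>

locale linear_functional =
  fixes I :: "('z \<Rightarrow> real) \<Rightarrow> real"
  assumes linear: "\<And>u v t. I (\<lambda>z. u z + t * v z) = I u + t * I v"
begin

abbreviation W :: "'i set \<Rightarrow> ('i \<Rightarrow> 'z \<Rightarrow> real) \<Rightarrow> real" where
  "W \<equiv> signed_cycle_sum I"

lemma signed_cycle_sum_upd_insert:
  assumes "finite S" "a \<notin> S"
  shows "W (insert a S) (f(a := k)) = (\<Sum>b\<in>S. W S (f(b := \<lambda>z. k z * f b z))) - I k * W S f"
proof -
  have "W S ((f(a := k))(b := \<lambda>z. (f(a := k)) a z * (f(a := k)) b z)) = W S (f(b := \<lambda>z. k z * f b z))"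
    if "b \<in> S" for b
    using that assms by (intro signed_cycle_sum_cong) auto
  moreover have "W S (f(a := k)) = W S f"
    using assms by (intro signed_cycle_sum_cong) auto
  ultimately show ?thesis
    using assms by (simp add: signed_cycle_sum_insert)
qed

text \<open>
  Each permutation has exactly one cycle through \<open>a\<close>, so the sum is linear in \<open>f a\<close>.  With the recursion,
  this is an induction in which the linear argument moves from position \<open>a\<close> to position \<open>b\<close>.
\<close>

lemma signed_cycle_sum_linear:
  assumes "finite S" "a \<in> S"
  shows "W S (f(a := \<lambda>z. g z + t * h z)) = W S (f(a := g)) + t * W S (f(a := h))"
  using assms
proof (induction S arbitrary: a f g h rule: finite_psubset_induct)
  case (psubset S)
  let ?R = "S - {a}"
  have S: "insert a ?R = S" and R: "finite ?R" "a \<notin> ?R"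
    using psubset by auto
  have "W ?R (f(b := \<lambda>z. (g z + t * h z) * f b z))
      = W ?R (f(b := \<lambda>z. g z * f b z)) + t * W ?R (f(b := \<lambda>z. h z * f b z))" if "b \<in> ?R" for b
  proof -
    have "W ?R (f(b := \<lambda>z. g z * f b z + t * (h z * f b z)))
        = W ?R (f(b := \<lambda>z. g z * f b z)) + t * W ?R (f(b := \<lambda>z. h z * f b z))"
      by (rule psubset.IH) (use that psubset.prems in auto)
    then show ?thesis
      by (simp only: distrib_right mult.assoc)
  qed
  then have "(\<Sum>b\<in>?R. W ?R (f(b := \<lambda>z. (g z + t * h z) * f b z)))
      = (\<Sum>b\<in>?R. W ?R (f(b := \<lambda>z. g z * f b z))) + t * (\<Sum>b\<in>?R. W ?R (f(b := \<lambda>z. h z * f b z)))"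
    by (simp only: sum.distrib sum_distrib_left cong: sum.cong)
  then have "W S (f(a := \<lambda>z. g z + t * h z)) = W S (f(a := g)) + t * W S (f(a := h))"
    unfolding signed_cycle_sum_upd_insert[OF R, of f, unfolded S] linear
    by (simp only:) (simp add: algebra_simps)
  then show ?case .
qed

lemma signed_cycle_sum_scale:
  assumes "finite S" "a \<in> S"
  shows "W S (f(a := \<lambda>z. t * h z)) = t * W S (f(a := h))"
proof -
  have "W S (f(a := \<lambda>z. 0)) = 0"
    using signed_cycle_sum_linear[OF assms, of f "\<lambda>z. 0" 1 "\<lambda>z. 0"] by simp
  then show ?thesis
    using signed_cycle_sum_linear[OF assms, of f "\<lambda>z. 0" t h] by simp
qed

text \<open>
  A function equal to \<open>1\<close> changes nothing in each of the \<open>card S\<close> places where its index joins a cycle,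
  and a cycle of its own contributes \<open>- 1\<close>.  The factor is non-negative as soon as \<open>S\<close> is non-empty.
\<close>

lemma signed_cycle_sum_one:
  assumes "finite S" "a \<notin> S" "I (\<lambda>z. 1) = 1"
  shows "W (insert a S) (f(a := \<lambda>z. 1)) = (real (card S) - 1) * W S f"
  using assms by (simp add: signed_cycle_sum_upd_insert algebra_simps)

text \<open>
  Enlarging one set \<open>D\<close> changes the sum by the contributions of the added points.  The contribution of a
  point \<open>p\<close> is the sum with \<open>indicator {p}\<close> in place of the function \<open>f a\<close>.
\<close>

lemma signed_cycle_sum_add_points:
  assumes "finite S" "a \<in> S" "finite X" "D \<inter> X = {}"
  shows "W S (f(a := indicator (D \<union> X))) = W S (f(a := indicator D)) + (\<Sum>p\<in>X. W S (f(a := indicator {p})))"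
  using assms(3,4)
proof (induction X rule: finite_induct)
  case (insert p X)
  have "indicator (D \<union> insert p X) = (\<lambda>z. indicator (D \<union> X) z + 1 * indicator {p} z :: real)"
    using insert by (auto simp: indicator_def fun_eq_iff)
  then have "W S (f(a := indicator (D \<union> insert p X)))
      = W S (f(a := indicator (D \<union> X))) + 1 * W S (f(a := indicator {p}))"
    using signed_cycle_sum_linear[OF assms(1,2), of f "indicator (D \<union> X)" 1 "indicator {p}"] by simp
  moreover have "W S (f(a := indicator (D \<union> X))) = W S (f(a := indicator D)) + (\<Sum>p\<in>X. W S (f(a := indicator {p})))"
    using insert by blast
  ultimately show ?case
    using insert.hyps by (simp add: fun_upd_def)
qed (simp add: fun_upd_def)

text \<open>
  A product with a point indicator is a multiple of that point indicator, so the recursion stays within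
  sums of this kind.
\<close>

lemma signed_cycle_sum_point:
  assumes "finite S" "a \<notin> S"
  shows "W (insert a S) (f(a := indicator {p}))
    = (\<Sum>b\<in>S. f b p * W S (f(b := indicator {p}))) - I (indicator {p}) * W S f"
proof -
  have "W S (f(b := \<lambda>z. indicator {p} z * f b z)) = f b p * W S (f(b := indicator {p}))" if "b \<in> S" for b
  proof -
    have "(\<lambda>z. indicator {p} z * f b z) = (\<lambda>z. f b p * indicator {p} z)"
      by (auto simp: indicator_def)
    then show ?thesis
      using signed_cycle_sum_scale[OF assms(1) that, of f "f b p" "indicator {p}"] by simp
  qed
  then show ?thesis
    by (simp add: signed_cycle_sum_upd_insert[OF assms])
qed

lemma signed_cycle_sum_point_cong:
  assumes "finite S" "a \<in> S"
    and "\<And>k. k \<in> S - {a} \<Longrightarrow> f k p = f k q"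
    and I: "I (indicator {p}) = I (indicator {q})"
  shows "W S (f(a := indicator {p})) = W S (f(a := indicator {q}))"
  using assms(1-3)
proof (induction S arbitrary: a rule: finite_psubset_induct)
  case (psubset S)
  let ?R = "S - {a}"
  have S: "insert a ?R = S" and R: "finite ?R" "a \<notin> ?R"
    using psubset by auto
  have "W ?R (f(b := indicator {p})) = W ?R (f(b := indicator {q}))" if "b \<in> ?R" for b
    by (rule psubset.IH) (use psubset.prems that in auto)
  then have "(\<Sum>b\<in>?R. f b p * W ?R (f(b := indicator {p}))) = (\<Sum>b\<in>?R. f b q * W ?R (f(b := indicator {q})))"
    using psubset.prems(2) by (intro sum.cong) auto
  then have "W S (f(a := indicator {p})) = W S (f(a := indicator {q}))"
    using signed_cycle_sum_point[OF R, of f p, unfolded S]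
      signed_cycle_sum_point[OF R, of f q, unfolded S] I by simp
  then show ?case .
qed

text \<open>
  If some other function vanishes at \<open>p\<close>, then no permutation whose cycle through \<open>a\<close> uses all indices
  contributes.  Every other choice of that cycle leaves a non-empty index set \<open>T\<close> with a sum \<open>\<le> 0\<close>, and the
  sign of the cycle itself makes the product \<open>\<ge> 0\<close>.
\<close>

lemma signed_cycle_sum_point_nonneg:
  assumes "finite S" "a \<in> S" "k \<in> S - {a}" "f k p = 0"
    and "\<And>T. T \<subseteq> S - {a} \<Longrightarrow> T \<noteq> {} \<Longrightarrow> W T f \<le> 0"
    and "\<And>i. i \<in> S - {a} \<Longrightarrow> f i p \<ge> 0"
    and I: "I (indicator {p}) \<ge> 0"
  shows "W S (f(a := indicator {p})) \<ge> 0"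
  using assms(1-6)
proof (induction S arbitrary: a rule: finite_psubset_induct)
  case (psubset S)
  let ?R = "S - {a}"
  have S: "insert a ?R = S" and R: "finite ?R" "a \<notin> ?R"
    using psubset by auto
  have "f b p * W ?R (f(b := indicator {p})) \<ge> 0" if b: "b \<in> ?R" for b
  proof (cases "b = k")
    case True
    then show ?thesis using psubset.prems by simp
  next
    case False
    have "W ?R (f(b := indicator {p})) \<ge> 0"
    proof (rule psubset.IH)
      show "W T f \<le> 0" if "T \<subseteq> ?R - {b}" "T \<noteq> {}" for T
        using that psubset.prems(4)[of T] by blast
    qed (use psubset.prems b False in auto)
    then show ?thesis
      using psubset.prems(5)[OF b] by simp
  qed
  moreover have "I (indicator {p}) * W ?R f \<le> 0"
    using psubset.prems(2) psubset.prems(4)[of ?R] I by (intro mult_nonneg_nonpos) auto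
  ultimately have "W S (f(a := indicator {p})) \<ge> 0"
    using signed_cycle_sum_point[OF R, of f p, unfolded S]
      sum_nonneg[of ?R "\<lambda>b. f b p * W ?R (f(b := indicator {p}))"] by simp
  then show ?case .
qed

end

section \<open>Staircases in a grid\<close>

definition staircases :: "nat \<Rightarrow> (nat \<times> nat) set set" where
  "staircases N = {D. D \<subseteq> {..<N} \<times> {..<N} \<and>
    (\<forall>x y x' y'. (x, y) \<in> D \<longrightarrow> x' \<le> x \<longrightarrow> y' \<le> y \<longrightarrow> (x', y') \<in> D)}"

lemma staircaseD:
  assumes "D \<in> staircases N" "(x, y) \<in> D" "x' \<le> x" "y' \<le> y"
  shows "(x', y') \<in> D"
  using assms unfolding staircases_def by blast

lemma staircase_subset: "D \<in> staircases N \<Longrightarrow> D \<subseteq> {..<N} \<times> {..<N}"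
  unfolding staircases_def by blast

lemma finite_staircase: "D \<in> staircases N \<Longrightarrow> finite D"
  by (rule finite_subset[OF staircase_subset]) auto

lemma finite_staircases: "finite (staircases N)"
  by (rule finite_subset[of _ "Pow ({..<N} \<times> {..<N})"]) (auto simp: staircases_def)

text \<open>
  An inner corner is a minimal point of the complement: a place where a single point can be added.
\<close>

definition inner_corner :: "nat \<Rightarrow> (nat \<times> nat) set \<Rightarrow> nat \<Rightarrow> nat \<Rightarrow> bool" where
  "inner_corner N D x y \<longleftrightarrow> x < N \<and> y < N \<and> (x, y) \<notin> D
    \<and> (\<forall>x'<x. (x', y) \<in> D) \<and> (\<forall>y'<y. (x, y') \<in> D)"

lemma staircase_insert_inner_corner:
  assumes "D \<in> staircases N" "inner_corner N D x y"
  shows "insert (x, y) D \<in> staircases N"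
proof -
  have "(x', y') \<in> insert (x, y) D" if "(u, v) \<in> insert (x, y) D" "x' \<le> u" "y' \<le> v" for u v x' y'
  proof (cases "(u, v) \<in> D")
    case True
    then show ?thesis using staircaseD[OF assms(1)] that by blast
  next
    case False
    then have le: "x' \<le> x" "y' \<le> y"
      using that by auto
    consider "x' < x" | "y' < y" | "x' = x" "y' = y"
      using le by linarith
    then show ?thesis
    proof cases
      case 1
      then have "(x', y) \<in> D" using assms(2) by (simp add: inner_corner_def)
      then show ?thesis using staircaseD[OF assms(1), of x' y x' y'] le by blast
    next
      case 2
      then have "(x, y') \<in> D" using assms(2) by (simp add: inner_corner_def)
      then show ?thesis using staircaseD[OF assms(1), of x y' x' y'] le by blast
    qed auto
  qed
  then show ?thesis
    using staircase_subset[OF assms(1)] assms(2) unfolding staircases_def inner_corner_def by blast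
qed

text \<open>
  The leftmost column that is not full, and in it the lowest missing point.
\<close>

lemma inner_corner_exists:
  assumes "D \<in> staircases N" "D \<noteq> {..<N} \<times> {..<N}"
  shows "\<exists>x y. inner_corner N D x y"
proof -
  have "\<exists>x y. x < N \<and> y < N \<and> (x, y) \<notin> D"
    using assms staircase_subset[OF assms(1)] by auto
  then obtain x0 where x0: "\<exists>y. x0 < N \<and> y < N \<and> (x0, y) \<notin> D"
    by blast
  define x where "x = (LEAST x. \<exists>y. x < N \<and> y < N \<and> (x, y) \<notin> D)"
  have x: "\<exists>y. x < N \<and> y < N \<and> (x, y) \<notin> D"
    unfolding x_def by (rule LeastI[of _ x0]) (rule x0)
  then obtain y0 where y0: "x < N \<and> y0 < N \<and> (x, y0) \<notin> D"
    by blast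
  define y where "y = (LEAST y. x < N \<and> y < N \<and> (x, y) \<notin> D)"
  have y: "x < N \<and> y < N \<and> (x, y) \<notin> D"
    unfolding y_def by (rule LeastI[of _ y0]) (rule y0)
  have "(x', y) \<in> D" if "x' < x" for x'
    using not_less_Least[OF that[unfolded x_def]] y that by auto
  moreover have "(x, y') \<in> D" if "y' < y" for y'
    using not_less_Least[OF that[unfolded y_def]] y that by auto
  ultimately show ?thesis
    using y unfolding inner_corner_def by blast
qed

text \<open>
  The rows on which column \<open>x\<close> exceeds column \<open>Suc x\<close>.  Filling the gap raises column \<open>Suc x\<close> to the height of
  column \<open>x\<close>; cutting it lowers column \<open>x\<close> to the height of column \<open>Suc x\<close>.  Both keep a staircase.
\<close>

definition column_gap :: "(nat \<times> nat) set \<Rightarrow> nat \<Rightarrow> nat set" where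
  "column_gap D x = {t. (x, t) \<in> D \<and> (Suc x, t) \<notin> D}"

lemma finite_column_gap:
  assumes "D \<in> staircases N"
  shows "finite (column_gap D x)"
  by (rule finite_subset[of _ "{..<N}"]) (use staircase_subset[OF assms] in \<open>auto simp: column_gap_def\<close>)

lemma staircase_fill_gap:
  assumes "D \<in> staircases N" "Suc x < N"
  shows "D \<union> {Suc x} \<times> column_gap D x \<in> staircases N"
proof -
  let ?E = "D \<union> {Suc x} \<times> column_gap D x"
  have "(x', y') \<in> ?E" if uv: "(u, v) \<in> ?E" and le: "x' \<le> u" "y' \<le> v" for u v x' y'
  proof (cases "(u, v) \<in> D")
    case True
    then show ?thesis using staircaseD[OF assms(1)] le by blast
  next
    case False
    then have u: "u = Suc x" and "(x, v) \<in> D"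
      using uv by (auto simp: column_gap_def)
    then have *: "(w, y') \<in> D" if "w \<le> x" for w
      using staircaseD[OF assms(1)] le that by blast
    show ?thesis
    proof (cases "x' = Suc x")
      case True
      then show ?thesis using *[of x] by (auto simp: column_gap_def)
    next
      case False
      then show ?thesis using *[of x'] u le by auto
    qed
  qed
  moreover have "?E \<subseteq> {..<N} \<times> {..<N}"
    using staircase_subset[OF assms(1)] assms(2) by (auto simp: column_gap_def)
  ultimately show ?thesis
    unfolding staircases_def by blast
qed

lemma staircase_cut_gap:
  assumes "D \<in> staircases N"
  shows "D - {x} \<times> column_gap D x \<in> staircases N"
proof -
  let ?E = "D - {x} \<times> column_gap D x"
  have "(x', y') \<in> ?E" if uv: "(u, v) \<in> ?E" and le: "x' \<le> u" "y' \<le> v" for u v x' y'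
  proof -
    have D: "(x', y') \<in> D" "(u, v) \<in> D"
      using staircaseD[OF assms] uv le by blast+
    have "(Suc x, y') \<in> D" if "x' = x"
    proof (cases "u = x")
      case True
      then have "(Suc x, v) \<in> D"
        using uv by (auto simp: column_gap_def)
      then show ?thesis using staircaseD[OF assms] le by blast
    next
      case False
      then have "Suc x \<le> u" using le that by simp
      then show ?thesis using staircaseD[OF assms] D le by blast
    qed
    then show ?thesis
      using D by (auto simp: column_gap_def)
  qed
  then show ?thesis
    using staircase_subset[OF assms] unfolding staircases_def by blast
qed

definition grid_mean :: "nat \<Rightarrow> (nat \<times> nat \<Rightarrow> real) \<Rightarrow> real" where
  "grid_mean N g = (\<Sum>z\<in>{..<N} \<times> {..<N}. g z) / (real N)\<^sup>2"

interpretation grid_mean: linear_functional "grid_mean N" for N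
proof
  show "grid_mean N (\<lambda>z. u z + t * v z) = grid_mean N u + t * grid_mean N v" for u v t
    unfolding grid_mean_def sum.distrib sum_distrib_left[symmetric] by (simp add: add_divide_distrib)
qed

lemma grid_mean_point: "p \<in> {..<N} \<times> {..<N} \<Longrightarrow> grid_mean N (indicator {p}) = 1 / (real N)\<^sup>2"
  unfolding grid_mean_def by (subst sum.remove[of _ p]) (auto intro!: sum.neutral)

lemma grid_mean_nonneg: "(\<And>z. g z \<ge> 0) \<Longrightarrow> grid_mean N g \<ge> 0"
  unfolding grid_mean_def by (intro divide_nonneg_nonneg sum_nonneg) auto

lemma finite_maximum:
  fixes g :: "'a \<Rightarrow> 'b::linorder"
  assumes "finite A" "A \<noteq> {}"
  shows "\<exists>x\<in>A. \<forall>y\<in>A. g y \<le> g x"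
proof -
  have "Max (g ` A) \<in> g ` A"
    using assms by (intro Max_in) auto
  then obtain x where "x \<in> A" "Max (g ` A) = g x"
    by blast
  moreover have "g y \<le> Max (g ` A)" if "y \<in> A" for y
    using assms that by simp
  ultimately show ?thesis
    by auto
qed

section \<open>The inequality for staircases\<close>

lemma staircase_grid_full: "{..<N} \<times> {..<N} \<in> staircases N"
  unfolding staircases_def by auto

lemma signed_cycle_sum_restrict_grid:
  assumes "finite S" "\<And>i z. i \<in> S \<Longrightarrow> z \<in> {..<N} \<times> {..<N} \<Longrightarrow> f i z = g i z"
  shows "signed_cycle_sum (grid_mean N) S f = signed_cycle_sum (grid_mean N) S g"
  unfolding signed_cycle_sum_def
proof (intro sum.cong prod.cong refl)
  fix \<sigma> c assume "\<sigma> \<in> {\<sigma>. \<sigma> permutes S}" "c \<in> orbit \<sigma> ` S"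
  then have c: "c \<subseteq> S"
    using permutes_orbit_subset by fastforce
  have "grid_mean N (\<lambda>z. \<Prod>i\<in>c. f i z) = grid_mean N (\<lambda>z. \<Prod>i\<in>c. g i z)"
    unfolding grid_mean_def using c assms(2) by (intro arg_cong2[where f = "(/)"] sum.cong prod.cong) auto
  then show "- grid_mean N (\<lambda>z. \<Prod>i\<in>c. f i z) = - grid_mean N (\<lambda>z. \<Prod>i\<in>c. g i z)"
    by simp
qed

text \<open>
  If the two columns \<open>x\<close> and \<open>Suc x\<close> of \<open>D'\<close> differed at a height \<open>t\<close> in the gap of \<open>D\<close>, then \<open>D'\<close> would have an
  inner corner in column \<open>Suc x\<close>, at a height \<open>s\<close> where \<open>(x, s)\<close> still belongs to \<open>D'\<close>.  This corner lies in \<open>D\<close>,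
  hence below the corner \<open>y\<close> of \<open>D\<close>; but the latter lies in \<open>D'\<close>, hence below \<open>s\<close>.
\<close>

lemma gap_columns_agree:
  assumes D: "D \<in> staircases N" and corner: "inner_corner N D (Suc x) y"
    and D': "D' \<in> staircases N"
    and in_D': "\<And>u v. inner_corner N D u v \<Longrightarrow> (u, v) \<in> D'"
    and in_D: "\<And>u v. inner_corner N D' u v \<Longrightarrow> (u, v) \<in> D"
    and t: "t \<in> column_gap D x"
  shows "(x, t) \<in> D' \<longleftrightarrow> (Suc x, t) \<in> D'"
proof
  assume "(Suc x, t) \<in> D'"
  then show "(x, t) \<in> D'"
    by (rule staircaseD[OF D']) auto
next
  assume xt: "(x, t) \<in> D'"
  show "(Suc x, t) \<in> D'"
  proof (rule ccontr)
    assume not: "(Suc x, t) \<notin> D'"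
    define s where "s = (LEAST s. (Suc x, s) \<notin> D')"
    have s: "(Suc x, s) \<notin> D'"
      unfolding s_def by (rule LeastI) (rule not)
    have "s \<le> t"
      unfolding s_def by (rule Least_le) (rule not)
    then have xs: "(x, s) \<in> D'"
      using staircaseD[OF D' xt, of x s] by simp
    have "inner_corner N D' (Suc x) s"
      unfolding inner_corner_def
    proof (intro conjI allI impI)
      show "Suc x < N" using corner by (simp add: inner_corner_def)
      show "s < N" using staircase_subset[OF D'] xs by auto
      show "(x', s) \<in> D'" if "x' < Suc x" for x'
        using staircaseD[OF D' xs] that by simp
      show "(Suc x, y') \<in> D'" if "y' < s" for y'
        using not_less_Least[OF that[unfolded s_def]] by simp
    qed (rule s)
    then have "(Suc x, s) \<in> D"
      by (rule in_D)
    then have "s < y"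
      using corner staircaseD[OF D, of "Suc x" s "Suc x" y] by (meson inner_corner_def le_refl linorder_not_less)
    moreover have "(Suc x, y) \<in> D'"
      by (rule in_D') (rule corner)
    ultimately show False
      using s staircaseD[OF D', of "Suc x" y "Suc x" s] by simp
  qed
qed

text \<open>
  The heart of the proof, by induction on the number of staircases.  Take a family \<open>E\<close> that maximizes the
  sum and, among the maximizers, has the largest total number of points; then enlarging a member of \<open>E\<close> strictly
  lowers the sum.

  If some member is the full grid, it splits off.  Otherwise each inner corner of a member lies in
  every other member, because a point outside another member has a non-negative contribution and could be
  added.  At an inner corner of \<open>E i\<close> in a column \<open>Suc x\<close>, the other members therefore do not distinguish the two
  columns within the gap, so that filling the gap changes the sum by some \<open>\<Delta>\<close> and cutting it changes the
  sum by \<open>- \<Delta>\<close>.  Filling strictly lowers the sum, hence cutting raises it, against maximality.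
  So all inner corners lie in column \<open>0\<close>.  For two members the lower of their corners
  in column \<open>0\<close> would be a missing point below a point of the same member.  Thus there is only one
  member, and the claim is that minus its mean is \<open>\<le> 0\<close>.
\<close>

theorem signed_cycle_sum_staircases_nonpos:
  fixes D :: "'i \<Rightarrow> (nat \<times> nat) set"
  assumes "N > 0" "finite S" "S \<noteq> {}" "\<And>i. i \<in> S \<Longrightarrow> D i \<in> staircases N"
  shows "signed_cycle_sum (grid_mean N) S (\<lambda>i. indicator (D i)) \<le> 0"
  using assms(2-4)
proof (induction S arbitrary: D rule: finite_psubset_induct)
  case (psubset S)
  let ?G = "{..<N} \<times> {..<N}"
  let ?W = "signed_cycle_sum (grid_mean N)"
  let ?\<phi> = "\<lambda>D i. indicator (D i) :: nat \<times> nat \<Rightarrow> real"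
  have IH: "?W T (?\<phi> D) \<le> 0" if "T \<subset> S" "T \<noteq> {}" "\<And>i. i \<in> T \<Longrightarrow> D i \<in> staircases N" for T D
    by (rule psubset.IH) (use that in auto)
  let ?C = "PiE S (\<lambda>_. staircases N)"
  have C: "finite ?C" "?C \<noteq> {}"
    using psubset.hyps finite_staircases staircase_grid_full by (auto intro!: finite_PiE simp: PiE_eq_empty_iff)
  define M where "M = {D \<in> ?C. \<forall>D'\<in>?C. ?W S (?\<phi> D') \<le> ?W S (?\<phi> D)}"
  have "finite M" "M \<noteq> {}"
    using finite_maximum[OF C, of "\<lambda>D. ?W S (?\<phi> D)"] C unfolding M_def by auto
  then obtain E where E: "E \<in> M" and big: "\<And>D. D \<in> M \<Longrightarrow> (\<Sum>i\<in>S. card (D i)) \<le> (\<Sum>i\<in>S. card (E i))"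
    using finite_maximum[of M "\<lambda>D. \<Sum>i\<in>S. card (D i)"] by blast
  have st: "E i \<in> staircases N" if "i \<in> S" for i
    using E that unfolding M_def by auto
  have le_E: "?W S (?\<phi> D') \<le> ?W S (?\<phi> E)" if "\<And>i. i \<in> S \<Longrightarrow> D' i \<in> staircases N" for D'
  proof -
    have "restrict D' S \<in> ?C"
      using that by auto
    then have "?W S (?\<phi> (restrict D' S)) \<le> ?W S (?\<phi> E)"
      using E unfolding M_def by blast
    also have "?W S (?\<phi> (restrict D' S)) = ?W S (?\<phi> D')"
      using psubset.hyps by (intro signed_cycle_sum_cong) auto
    finally show ?thesis .
  qed
  have upd: "?\<phi> (E(i := X)) = (?\<phi> E)(i := indicator X)" for i X
    by auto
  have le_upd: "?W S ((?\<phi> E)(i := indicator X)) \<le> ?W S (?\<phi> E)" if "X \<in> staircases N" for i X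
    unfolding upd[symmetric] by (rule le_E) (use that st in auto)
  have stuck: "?W S ((?\<phi> E)(i := indicator (E i \<union> X))) < ?W S (?\<phi> E)"
    if i: "i \<in> S" and X: "E i \<union> X \<in> staircases N" "E i \<inter> X = {}" "X \<noteq> {}" for i X
  proof (rule ccontr)
    let ?E' = "E(i := E i \<union> X)"
    assume "\<not> ?thesis"
    then have "?W S (?\<phi> ?E') = ?W S (?\<phi> E)"
      unfolding upd using le_upd[OF X(1), of i] by simp
    moreover have "?E' \<in> ?C"
      using E i X unfolding M_def by (auto simp: PiE_iff extensional_def)
    ultimately have "?E' \<in> M"
      using E unfolding M_def by auto
    then have "(\<Sum>j\<in>S. card (?E' j)) \<le> (\<Sum>j\<in>S. card (E j))"
      by (rule big)
    moreover have "card (E i) < card (?E' i)"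
      using X finite_staircase[OF X(1)] by (auto intro!: psubset_card_mono)
    then have "(\<Sum>j\<in>S. card (E j)) < (\<Sum>j\<in>S. card (?E' j))"
      using psubset.hyps i by (intro sum_strict_mono_ex1) auto
    ultimately show False
      by simp
  qed
  have add: "?W S ((?\<phi> E)(i := indicator (X \<union> Y))) = ?W S ((?\<phi> E)(i := indicator X)) + (\<Sum>p\<in>Y. ?W S ((?\<phi> E)(i := indicator {p})))"
    if "i \<in> S" "finite Y" "X \<inter> Y = {}" for i X Y
    by (rule grid_mean.signed_cycle_sum_add_points) (use that psubset.hyps in auto)
  have self: "(?\<phi> E)(i := indicator (E i)) = ?\<phi> E" for i
    by auto
  have "?W S (?\<phi> E) \<le> 0"
  proof (cases "\<exists>i\<in>S. E i = ?G")
    case True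
    then obtain a where a: "a \<in> S" "E a = ?G"
      by blast
    let ?R = "S - {a}"
    have R: "finite ?R" "a \<notin> ?R" "insert a ?R = S"
      using a psubset.hyps by auto
    have one: "grid_mean N (\<lambda>z. 1) = 1"
      using \<open>N > 0\<close> by (simp add: grid_mean_def power2_eq_square)
    have "?W S (?\<phi> E) = ?W S ((?\<phi> E)(a := \<lambda>z. 1))"
      using psubset.hyps a by (intro signed_cycle_sum_restrict_grid) auto
    also have "\<dots> = (real (card ?R) - 1) * ?W ?R (?\<phi> E)"
      using grid_mean.signed_cycle_sum_one[OF R(1,2) one, of "?\<phi> E"] R(3) by simp
    also have "\<dots> \<le> 0"
    proof (cases "?R = {}")
      case True
      then show ?thesis by (simp only:) simp
    next
      case False
      have "?W ?R (?\<phi> E) \<le> 0"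
        by (rule IH) (use False a st in auto)
      moreover have "real (card ?R) - 1 \<ge> 0"
        using False R(1) by (simp add: Suc_leI card_gt_0_iff)
      ultimately show ?thesis
        by (intro mult_nonneg_nonpos) auto
    qed
    finally show ?thesis .
  next
    case False
    have corner_in: "(x, y) \<in> E k" if i: "i \<in> S" and k: "k \<in> S" "k \<noteq> i" and xy: "inner_corner N (E i) x y" for i k x y
    proof (rule ccontr)
      assume "(x, y) \<notin> E k"
      have "?W S ((?\<phi> E)(i := indicator {(x, y)})) \<ge> 0"
      proof (rule grid_mean.signed_cycle_sum_point_nonneg[where k = k])
        show "?W T (?\<phi> E) \<le> 0" if "T \<subseteq> S - {i}" "T \<noteq> {}" for T
          by (rule IH) (use that i st in auto)
        show "grid_mean N (indicator {(x, y)}) \<ge> 0"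
          by (rule grid_mean_nonneg) auto
      qed (use psubset.hyps i k \<open>(x, y) \<notin> E k\<close> in auto)
      moreover have "E i \<union> {(x, y)} \<in> staircases N"
        using staircase_insert_inner_corner[OF st[OF i] xy] by simp
      moreover have "E i \<inter> {(x, y)} = {}"
        using xy by (simp add: inner_corner_def)
      ultimately show False
        using stuck[OF i, of "{(x, y)}"] add[OF i, of "{(x, y)}" "E i"] unfolding self by simp
    qed
    show ?thesis
    proof (cases "\<exists>i\<in>S. \<exists>x y. inner_corner N (E i) (Suc x) y")
      case True
      then obtain i x y where i: "i \<in> S" and xy: "inner_corner N (E i) (Suc x) y"
        by blast
      let ?T = "column_gap (E i) x"
      let ?K = "\<lambda>p. ?W S ((?\<phi> E)(i := indicator {p}))"
      have T: "finite ?T"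
        by (rule finite_column_gap) (rule st[OF i])
      have "y \<in> ?T"
        using xy by (simp add: column_gap_def inner_corner_def)
      have sub: "E i \<subseteq> ?G"
        by (rule staircase_subset) (rule st[OF i])
      have xN: "Suc x < N"
        using xy by (simp add: inner_corner_def)
      have "?K (Suc x, t) = ?K (x, t)" if t: "t \<in> ?T" for t
      proof (rule grid_mean.signed_cycle_sum_point_cong)
        fix k assume k: "k \<in> S - {i}"
        have "(x, t) \<in> E k \<longleftrightarrow> (Suc x, t) \<in> E k"
          by (rule gap_columns_agree[OF st[OF i] xy st _ _ t]) (use k i corner_in in auto)
        then show "?\<phi> E k (Suc x, t) = ?\<phi> E k (x, t)"
          by (auto simp: indicator_def)
      next
        have "t < N"
          using t sub by (auto simp: column_gap_def)
        then show "grid_mean N (indicator {(Suc x, t)}) = grid_mean N (indicator {(x, t)})"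
          using xN by (simp add: grid_mean_point)
      qed (use psubset.hyps i in auto)
      then have K: "(\<Sum>p\<in>{Suc x} \<times> ?T. ?K p) = (\<Sum>p\<in>{x} \<times> ?T. ?K p)"
        by (simp add: sum.cartesian_product')
      have "?W S ((?\<phi> E)(i := indicator (E i \<union> {Suc x} \<times> ?T))) < ?W S (?\<phi> E)"
      proof (rule stuck[OF i])
        show "E i \<union> {Suc x} \<times> ?T \<in> staircases N"
          by (rule staircase_fill_gap) (use st[OF i] xN in auto)
      qed (use \<open>y \<in> ?T\<close> in \<open>auto simp: column_gap_def\<close>)
      moreover have "?W S ((?\<phi> E)(i := indicator (E i \<union> {Suc x} \<times> ?T))) = ?W S (?\<phi> E) + (\<Sum>p\<in>{Suc x} \<times> ?T. ?K p)"
        using add[OF i, of "{Suc x} \<times> ?T" "E i"] T unfolding self by (auto simp: column_gap_def)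
      ultimately have neg: "(\<Sum>p\<in>{x} \<times> ?T. ?K p) < 0"
        using K by linarith
      \<comment> \<open>The points cut from column \<open>x\<close> contribute as much as those that would fill column \<open>Suc x\<close>.\<close>
      let ?E' = "E i - {x} \<times> ?T"
      have split: "?E' \<union> {x} \<times> ?T = E i"
        by (auto simp: column_gap_def)
      have "?W S ((?\<phi> E)(i := indicator (?E' \<union> {x} \<times> ?T)))
          = ?W S ((?\<phi> E)(i := indicator ?E')) + (\<Sum>p\<in>{x} \<times> ?T. ?K p)"
        by (rule add[OF i]) (use T in auto)
      then have "?W S (?\<phi> E) = ?W S ((?\<phi> E)(i := indicator ?E')) + (\<Sum>p\<in>{x} \<times> ?T. ?K p)"
        unfolding split self .
      moreover have "?W S ((?\<phi> E)(i := indicator ?E')) \<le> ?W S (?\<phi> E)"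
        by (rule le_upd, rule staircase_cut_gap) (rule st[OF i])
      ultimately have False
        using neg by linarith
      then show ?thesis ..
    next
      case no_Suc: False
      have left: "\<exists>y. inner_corner N (E i) 0 y" if "i \<in> S" for i
        using inner_corner_exists[OF st[OF that]] False that no_Suc by (metis not0_implies_Suc)
      have "S = {i}" if i: "i \<in> S" for i
      proof (rule ccontr)
        assume "S \<noteq> {i}"
        then obtain k where k: "k \<in> S" "k \<noteq> i"
          using i by blast
        obtain y z where y: "inner_corner N (E i) 0 y" and z: "inner_corner N (E k) 0 z"
          using left i k by blast
        have "(0, y) \<in> E k" "(0, z) \<in> E i"
          using corner_in i k y z by blast+
        then show False
          using y z staircaseD[OF st[OF i], of 0 z 0 y] staircaseD[OF st[OF k(1)], of 0 y 0 z]
          by (auto simp: inner_corner_def dest: nat_le_linear[of y z, THEN disjE])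
      qed
      then obtain i where "S = {i}"
        using psubset.prems(1) by blast
      then show ?thesis
        using signed_cycle_sum_insert[of "{}" i "grid_mean N" "?\<phi> E"]
          grid_mean_nonneg[of "?\<phi> E i" N] by simp
    qed
  qed
  then show ?case
    using le_E[of D] psubset.prems(2) by simp
qed

section \<open>Decreasing functions on a grid\<close>

definition grid_antimono :: "nat \<Rightarrow> (nat \<times> nat \<Rightarrow> real) \<Rightarrow> bool" where
  "grid_antimono N g \<longleftrightarrow> (\<forall>z\<in>{..<N} \<times> {..<N}. 0 \<le> g z) \<and>
    (\<forall>x y x' y'. x < N \<longrightarrow> y < N \<longrightarrow> x' \<le> x \<longrightarrow> y' \<le> y \<longrightarrow> g (x, y) \<le> g (x', y'))"

lemma grid_antimono_nonneg: "grid_antimono N g \<Longrightarrow> z \<in> {..<N} \<times> {..<N} \<Longrightarrow> 0 \<le> g z"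
  unfolding grid_antimono_def by blast

lemma grid_antimonoD:
  "grid_antimono N g \<Longrightarrow> x < N \<Longrightarrow> y < N \<Longrightarrow> x' \<le> x \<Longrightarrow> y' \<le> y \<Longrightarrow> g (x, y) \<le> g (x', y')"
  unfolding grid_antimono_def by blast

text \<open>
  By linearity \<open>f a\<close> can be reduced step by step: subtracting the indicator of its support, multiplied by
  its smallest positive value, leaves a function of the same kind with smaller support.
\<close>

lemma signed_cycle_sum_layer_cake:
  assumes "finite S" "a \<in> S" "grid_antimono N (f a)"
    and base: "\<And>D. D \<in> staircases N \<Longrightarrow> signed_cycle_sum (grid_mean N) S (f(a := indicator D)) \<le> 0"
  shows "signed_cycle_sum (grid_mean N) S f \<le> 0"
proof -
  let ?G = "{..<N} \<times> {..<N}"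
  let ?W = "signed_cycle_sum (grid_mean N) S"
  have "?W (f(a := g)) \<le> 0" if "grid_antimono N g" for g
    using that
  proof (induction "card {z \<in> ?G. 0 < g z}" arbitrary: g rule: less_induct)
    case less
    define D where "D = {z \<in> ?G. 0 < g z}"
    have "(x', y') \<in> D" if "(x, y) \<in> D" "x' \<le> x" "y' \<le> y" for x y x' y'
      using grid_antimonoD[OF less.prems, of x y x' y'] that by (simp add: D_def)
    then have D: "D \<in> staircases N"
      unfolding staircases_def by (auto simp: D_def)
    have zero: "g z = 0" if "z \<in> ?G" "z \<notin> D" for z
      using that grid_antimono_nonneg[OF less.prems that(1)] by (simp add: D_def)
    show ?case
    proof (cases "D = {}")
      case True
      have "?W (f(a := g)) = ?W (f(a := indicator {}))"
        using zero True assms(1) by (intro signed_cycle_sum_restrict_grid) auto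
      then show ?thesis
        using base[of "{}"] by (simp add: staircases_def)
    next
      case False
      have fin: "finite D"
        by (rule finite_staircase[OF D])
      define m where "m = Min (g ` D)"
      have "m \<in> g ` D"
        unfolding m_def using fin False by (intro Min_in) auto
      then obtain z0 where z0: "z0 \<in> D" "m = g z0"
        by blast
      then have "m > 0"
        by (simp add: D_def)
      have m_le: "m \<le> g z" if "z \<in> D" for z
        unfolding m_def using that fin by (intro Min_le) auto
      define h where "h = (\<lambda>z. g z - m * indicator D z)"
      have h: "grid_antimono N h"
        unfolding grid_antimono_def
      proof (intro conjI allI impI ballI)
        show "0 \<le> h z" if "z \<in> ?G" for z
          using that m_le zero by (cases "z \<in> D") (auto simp: h_def)
        show "h (x, y) \<le> h (x', y')" if "x < N" "y < N" "x' \<le> x" "y' \<le> y" for x y x' y'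
        proof (cases "(x, y) \<in> D")
          case True
          then have "(x', y') \<in> D"
            using staircaseD[OF D] that by blast
          then show ?thesis
            using True grid_antimonoD[OF less.prems that] by (simp add: h_def)
        next
          case False
          then show ?thesis
            using zero[of "(x, y)"] m_le[of "(x', y')"] zero[of "(x', y')"] that
            by (cases "(x', y') \<in> D") (auto simp: h_def)
        qed
      qed
      have "{z \<in> ?G. 0 < h z} \<subset> D"
      proof
        show "{z \<in> ?G. 0 < h z} \<subseteq> D"
        proof
          fix z assume "z \<in> {z \<in> ?G. 0 < h z}"
          then show "z \<in> D"
            using zero[of z] by (cases "z \<in> D") (simp_all add: h_def)
        qed
        have "h z0 = 0"
          using z0 by (simp add: h_def)
        moreover have "0 < h z0" if "{z \<in> ?G. 0 < h z} = D"
          using z0(1) that by blast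
        ultimately show "{z \<in> ?G. 0 < h z} \<noteq> D"
          by force
      qed
      then have "card {z \<in> ?G. 0 < h z} < card D"
        using fin by (intro psubset_card_mono)
      then have "?W (f(a := h)) \<le> 0"
        using less.hyps h unfolding D_def by blast
      moreover have "?W (f(a := \<lambda>z. h z + m * indicator D z)) = ?W (f(a := h)) + m * ?W (f(a := indicator D))"
        by (rule grid_mean.signed_cycle_sum_linear) (use assms in auto)
      moreover have "m * ?W (f(a := indicator D)) \<le> 0"
        using base[OF D] \<open>m > 0\<close> by (simp add: mult_nonneg_nonpos)
      ultimately show ?thesis
        by (simp add: h_def)
    qed
  qed
  from this[OF assms(3)] show ?thesis
    by simp
qed

text \<open>
  The functions are replaced by staircase indicators one index at a time; \<open>U\<close> collects the indices that
  still carry a general function.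
\<close>

theorem signed_cycle_sum_grid_nonpos:
  assumes "N > 0" "finite S" "S \<noteq> {}" "\<And>i. i \<in> S \<Longrightarrow> grid_antimono N (f i)"
  shows "signed_cycle_sum (grid_mean N) S f \<le> 0"
proof -
  have "signed_cycle_sum (grid_mean N) S f \<le> 0"
    if "finite U" "U \<subseteq> S" "\<And>i. i \<in> U \<Longrightarrow> grid_antimono N (f i)"
      "\<And>i. i \<in> S - U \<Longrightarrow> \<exists>D\<in>staircases N. f i = indicator D" for U f
    using that
  proof (induction U arbitrary: f rule: finite_induct)
    case empty
    then obtain D where D: "\<And>i. i \<in> S \<Longrightarrow> D i \<in> staircases N \<and> f i = indicator (D i)"
      by simp metis
    have "signed_cycle_sum (grid_mean N) S f = signed_cycle_sum (grid_mean N) S (\<lambda>i. indicator (D i))"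
      using D assms(2) by (intro signed_cycle_sum_cong) auto
    also have "\<dots> \<le> 0"
      by (rule signed_cycle_sum_staircases_nonpos) (use assms D in auto)
    finally show ?case .
  next
    case (insert a U)
    show ?case
    proof (rule signed_cycle_sum_layer_cake[where a = a])
      show "signed_cycle_sum (grid_mean N) S (f(a := indicator D)) \<le> 0" if "D \<in> staircases N" for D
        by (rule insert.IH) (use insert that in auto)
    qed (use insert assms(2) in auto)
  qed
  from this[of S f] show ?thesis
    using assms by auto
qed

section \<open>Riemann sums of decreasing functions on the square\<close>

definition grid_point :: "nat \<Rightarrow> nat \<times> nat \<Rightarrow> real^2" where
  "grid_point N z = vector [real (fst z) / real N, real (snd z) / real N]"

lemma grid_point_nth [simp]:
  "grid_point N z $ 1 = real (fst z) / real N" "grid_point N z $ 2 = real (snd z) / real N"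
  by (simp_all add: grid_point_def)

lemma vec2_le_iff: "x \<le> y \<longleftrightarrow> x $ 1 \<le> y $ 1 \<and> x $ 2 \<le> y $ 2" for x y :: "real^2"
  by (simp add: less_eq_vec_def forall_2)

lemma grid_point_mono: "fst z \<le> fst w \<Longrightarrow> snd z \<le> snd w \<Longrightarrow> grid_point N z \<le> grid_point N w"
  by (simp add: vec2_le_iff divide_right_mono)

lemma grid_point_in_square: "N > 0 \<Longrightarrow> fst z \<le> N \<Longrightarrow> snd z \<le> N \<Longrightarrow> grid_point N z \<in> {0..1}"
  by (simp add: vec2_le_iff)

abbreviation next_cell :: "nat \<times> nat \<Rightarrow> nat \<times> nat" where
  "next_cell z \<equiv> (Suc (fst z), Suc (snd z))"

lemma content_grid_cell:
  assumes "N > 0"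
  shows "measure lebesgue (cbox (grid_point N z) (grid_point N (next_cell z))) = 1 / (real N)\<^sup>2"
    "measure lebesgue (box (grid_point N z) (grid_point N (next_cell z))) = 1 / (real N)\<^sup>2"
proof -
  let ?a = "grid_point N z" and ?b = "grid_point N (next_cell z)"
  have "?a \<in> cbox ?a ?b"
    by (simp add: mem_box_cart forall_2 divide_right_mono)
  then have "measure lborel (cbox ?a ?b) = (\<Prod>i\<in>UNIV. ?b $ i - ?a $ i)"
    by (intro content_cbox_cart) blast
  also have "\<dots> = 1 / (real N)\<^sup>2"
    by (simp add: UNIV_2 diff_divide_distrib[symmetric] power2_eq_square)
  finally show c: "measure lebesgue (cbox ?a ?b) = 1 / (real N)\<^sup>2"
    by simp
  have "measure lborel (box ?a ?b) = measure lborel (cbox ?a ?b)"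
    by (simp add: measure_lborel_box_eq measure_lborel_cbox_eq)
  then show "measure lebesgue (box ?a ?b) = 1 / (real N)\<^sup>2"
    using c by simp
qed

lemma unit_square_cbox: "{0..1} = cbox 0 (1 :: real^2)"
  by (auto simp: mem_box_cart less_eq_vec_def)

lemma has_integral_step_function:
  fixes A :: "'a \<Rightarrow> (real^2) set" and c :: "'a \<Rightarrow> real"
  assumes "finite Z" "\<And>z. z \<in> Z \<Longrightarrow> A z \<in> lmeasurable" "\<And>z. z \<in> Z \<Longrightarrow> A z \<subseteq> {0..1}"
  shows "((\<lambda>x. \<Sum>z\<in>Z. c z * indicator (A z) x) has_integral (\<Sum>z\<in>Z. c z * measure lebesgue (A z))) {0..1}"
proof (rule has_integral_sum[OF assms(1)])
  fix z assume z: "z \<in> Z"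
  have "{0..1} \<inter> A z = A z" "A z \<inter> {0..1} = A z"
    using assms(3)[OF z] by auto
  then have "(indicator (A z) has_integral measure lebesgue (A z)) {0..1}"
    using assms(2)[OF z] by (simp add: has_integral_iff integrable_on_indicator integral_indicator)
  then show "((\<lambda>x. c z * indicator (A z) x) has_integral c z * measure lebesgue (A z)) {0..1}"
    by (rule has_integral_mult_right)
qed

text \<open>
  Shifting one coordinate telescopes, and each of the two shifts leaves \<open>N\<close> boundary differences.
\<close>

lemma riemann_sum_gap:
  fixes a :: "nat \<times> nat \<Rightarrow> real"
  assumes "\<And>i j. i \<le> N \<Longrightarrow> j \<le> N \<Longrightarrow> 0 \<le> a (i, j)" "\<And>i j. i \<le> N \<Longrightarrow> j \<le> N \<Longrightarrow> a (i, j) \<le> a (0, 0)"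
  shows "(\<Sum>z\<in>{..<N} \<times> {..<N}. a z) - (\<Sum>z\<in>{..<N} \<times> {..<N}. a (next_cell z)) \<le> 2 * real N * a (0, 0)"
proof -
  have tele: "(\<Sum>j<N. b j) - (\<Sum>j<N. b (Suc j)) = b 0 - b N" for b :: "nat \<Rightarrow> real"
    by (simp add: sum_subtractf[symmetric] sum_lessThan_telescope')
  have "(\<Sum>i<N. \<Sum>j<N. a (i, j)) - (\<Sum>i<N. \<Sum>j<N. a (i, Suc j))
      = (\<Sum>i<N. (\<Sum>j<N. a (i, j)) - (\<Sum>j<N. a (i, Suc j)))"
    by (simp only: sum_subtractf)
  also have "\<dots> = (\<Sum>i<N. a (i, 0) - a (i, N))"
    by (rule sum.cong[OF refl]) (rule tele)
  also have "\<dots> \<le> (\<Sum>i<N. a (0, 0))"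
  proof (rule sum_mono)
    fix i assume "i \<in> {..<N}"
    then show "a (i, 0) - a (i, N) \<le> a (0, 0)"
      using assms(1)[of i N] assms(2)[of i 0] by simp
  qed
  finally have 1: "(\<Sum>i<N. \<Sum>j<N. a (i, j)) - (\<Sum>i<N. \<Sum>j<N. a (i, Suc j)) \<le> real N * a (0, 0)"
    by simp
  have "(\<Sum>i<N. \<Sum>j<N. a (i, Suc j)) - (\<Sum>i<N. \<Sum>j<N. a (Suc i, Suc j))
      = (\<Sum>j<N. (\<Sum>i<N. a (i, Suc j)) - (\<Sum>i<N. a (Suc i, Suc j)))"
    unfolding sum_subtractf by (intro arg_cong2[where f = "(-)"] sum.swap)
  also have "\<dots> = (\<Sum>j<N. a (0, Suc j) - a (N, Suc j))"
    by (rule sum.cong[OF refl]) (rule tele)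
  also have "\<dots> \<le> (\<Sum>i<N. a (0, 0))"
  proof (rule sum_mono)
    fix j assume "j \<in> {..<N}"
    then show "a (0, Suc j) - a (N, Suc j) \<le> a (0, 0)"
      using assms(1)[of N "Suc j"] assms(2)[of 0 "Suc j"] by simp
  qed
  finally have 2: "(\<Sum>i<N. \<Sum>j<N. a (i, Suc j)) - (\<Sum>i<N. \<Sum>j<N. a (Suc i, Suc j)) \<le> real N * a (0, 0)"
    by simp
  show ?thesis
    using 1 2 by (simp add: sum.cartesian_product')
qed

text \<open>
  The step functions need no correction on cell boundaries because \<open>g\<close> is non-negative: closed cells overlap and can
  only overestimate, while open cells omit their boundaries and can only underestimate.
\<close>

lemma riemann_bounds:
  fixes g :: "real^2 \<Rightarrow> real"
  assumes "N > 0" and nonneg: "\<And>x. x \<in> {0..1} \<Longrightarrow> 0 \<le> g x" and anti: "antimono_on {0..1} g"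
  defines "L \<equiv> grid_mean N (\<lambda>z. g (grid_point N (next_cell z)))"
    and "U \<equiv> grid_mean N (\<lambda>z. g (grid_point N z))"
  shows "\<exists>l u. (l has_integral L) {0..1} \<and> (u has_integral U) {0..1} \<and> (\<forall>x\<in>{0..1}. l x \<le> g x \<and> g x \<le> u x)"
    and "U - L \<le> 2 * g 0 / N"
proof -
  let ?G = "{..<N} \<times> {..<N}" and ?p = "grid_point N"
  let ?q = "\<lambda>z. ?p (next_cell z)"
  have le: "g y \<le> g x" if "x \<in> {0..1}" "y \<in> {0..1}" "x \<le> y" for x y
    using anti that by (simp add: monotone_on_def)
  have in_sq: "?p z \<in> {0..1}" "?q z \<in> {0..1}" if "z \<in> ?G" for z
    by (intro grid_point_in_square; use that \<open>N > 0\<close> in auto)+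
  have cells: "cbox (?p z) (?q z) \<subseteq> {0..1}" "box (?p z) (?q z) \<subseteq> {0..1}" if "z \<in> ?G" for z
  proof -
    show "cbox (?p z) (?q z) \<subseteq> {0..1}"
      using in_sq[OF that] unfolding interval_cbox_cart[symmetric] by simp
    then show "box (?p z) (?q z) \<subseteq> {0..1}"
      using box_subset_cbox by (rule order_trans[rotated])
  qed
  define l where "l = (\<lambda>x. \<Sum>z\<in>?G. g (?q z) * indicator (box (?p z) (?q z)) x)"
  define u where "u = (\<lambda>x. \<Sum>z\<in>?G. g (?p z) * indicator (cbox (?p z) (?q z)) x)"
  have "(l has_integral (\<Sum>z\<in>?G. g (?q z) * measure lebesgue (box (?p z) (?q z)))) {0..1}"
    unfolding l_def
    by (rule has_integral_step_function[where A = "\<lambda>z. box (?p z) (?q z)" and c = "\<lambda>z. g (?q z)"]) (use cells in auto)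
  then have l: "(l has_integral L) {0..1}"
    unfolding content_grid_cell[OF \<open>N > 0\<close>] by (simp add: L_def grid_mean_def sum_divide_distrib)
  have "(u has_integral (\<Sum>z\<in>?G. g (?p z) * measure lebesgue (cbox (?p z) (?q z)))) {0..1}"
    unfolding u_def
    by (rule has_integral_step_function[where A = "\<lambda>z. cbox (?p z) (?q z)" and c = "\<lambda>z. g (?p z)"]) (use cells in auto)
  then have u: "(u has_integral U) {0..1}"
    unfolding content_grid_cell[OF \<open>N > 0\<close>] by (simp add: U_def grid_mean_def sum_divide_distrib)
  have "l x \<le> g x" if x: "x \<in> {0..1}" for x
  proof (cases "\<exists>z\<in>?G. x \<in> box (?p z) (?q z)")
    case False
    then have "l x = 0"
      unfolding l_def by (intro sum.neutral) auto
    then show ?thesis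
      using nonneg[OF x] by simp
  next
    case True
    then obtain z where z: "z \<in> ?G" "x \<in> box (?p z) (?q z)"
      by blast
    have unique: "w = z" if "x \<in> box (?p w) (?q w)" for w
    proof -
      have "real (fst v) < N * x $ 1 \<and> N * x $ 1 < real (Suc (fst v))
          \<and> real (snd v) < N * x $ 2 \<and> N * x $ 2 < real (Suc (snd v))" if "x \<in> box (?p v) (?q v)" for v
        using that \<open>N > 0\<close> by (simp add: mem_box_cart forall_2 field_simps)
      from this[OF that] this[OF z(2)] have "real (fst w) < real (Suc (fst z))" "real (fst z) < real (Suc (fst w))"
        "real (snd w) < real (Suc (snd z))" "real (snd z) < real (Suc (snd w))"
        by linarith+
      then show ?thesis
        by (simp add: prod_eq_iff)
    qed
    have "l x = g (?q z) * indicator (box (?p z) (?q z)) x + (\<Sum>w\<in>?G - {z}. g (?q w) * indicator (box (?p w) (?q w)) x)"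
      unfolding l_def using z by (intro sum.remove) auto
    also have "(\<Sum>w\<in>?G - {z}. g (?q w) * indicator (box (?p w) (?q w)) x) = 0"
      using unique by (intro sum.neutral) (auto simp: indicator_def)
    finally have "l x = g (?q z)"
      using z by simp
    moreover have "x \<le> ?q z"
      using z by (simp add: mem_box_cart less_eq_vec_def less_imp_le)
    ultimately show ?thesis
      using le[OF x in_sq(2)[OF z(1)]] by simp
  qed
  moreover have "g x \<le> u x" if x: "x \<in> {0..1}" for x
  proof -
    have ex: "\<exists>k<N. real k / N \<le> t \<and> t \<le> real (Suc k) / N" if "0 \<le> t" "t \<le> 1" for t :: real
    \<comment> \<open>Rounding \<open>N * t\<close> up handles \<open>t = 1\<close>, which rounding down would put beyond the last cell.\<close>
    proof (cases "t = 0")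
      case True
      then show ?thesis using \<open>N > 0\<close> by (intro exI[of _ 0]) auto
    next
      case False
      define k where "k = nat \<lceil>N * t\<rceil> - 1"
      have pos: "0 < N * t" "N * t \<le> N"
        using that False \<open>N > 0\<close> by (auto simp: mult_left_le)
      then have ceil: "0 < \<lceil>N * t\<rceil>" "\<lceil>N * t\<rceil> \<le> N"
        by (auto simp: ceiling_le_iff)
      then have k: "real (Suc k) = of_int \<lceil>N * t\<rceil>" "k < N"
        unfolding k_def by linarith+
      then have "real k \<le> N * t" "N * t \<le> real (Suc k)"
        using ceiling_correct[of "N * t"] by auto
      then show ?thesis
        using k \<open>N > 0\<close> by (intro exI[of _ k]) (auto simp: field_simps)
    qed
    have "0 \<le> x $ 1" "x $ 1 \<le> 1" "0 \<le> x $ 2" "x $ 2 \<le> 1"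
      using x by (auto simp: vec2_le_iff)
    then obtain i j where ij: "i < N" "real i / N \<le> x $ 1" "x $ 1 \<le> real (Suc i) / N"
      "j < N" "real j / N \<le> x $ 2" "x $ 2 \<le> real (Suc j) / N"
      using ex[of "x $ 1"] ex[of "x $ 2"] by blast
    let ?z = "(i, j)"
    have z: "?z \<in> ?G" "x \<in> cbox (?p ?z) (?q ?z)" "?p ?z \<le> x"
      using ij by (auto simp: mem_box_cart forall_2 vec2_le_iff)
    have "g x \<le> g (?p ?z) * indicator (cbox (?p ?z) (?q ?z)) x"
      using z le[OF in_sq(1)[OF z(1)] x] by simp
    also have "\<dots> \<le> u x"
      unfolding u_def using z(1) in_sq(1) nonneg
      by (intro member_le_sum[where f = "\<lambda>z. g (?p z) * indicator (cbox (?p z) (?q z)) x"]) auto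
    finally show ?thesis .
  qed
  ultimately show "\<exists>l u. (l has_integral L) {0..1} \<and> (u has_integral U) {0..1} \<and> (\<forall>x\<in>{0..1}. l x \<le> g x \<and> g x \<le> u x)"
    using l u by blast
  have p0: "?p (0, 0) = 0"
    by (simp add: vec_eq_iff forall_2)
  have "(\<Sum>z\<in>?G. g (?p z)) - (\<Sum>z\<in>?G. g (?q z)) \<le> 2 * real N * g (?p (0, 0))"
  proof (rule riemann_sum_gap[where a = "\<lambda>z. g (?p z)"])
    fix i j assume "i \<le> N" "j \<le> N"
    then have "?p (i, j) \<in> {0..1}"
      using \<open>N > 0\<close> by (intro grid_point_in_square) auto
    then show "0 \<le> g (?p (i, j))" "g (?p (i, j)) \<le> g (?p (0, 0))"
      using nonneg le[of "?p (0, 0)"] p0 by auto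
  qed
  then have "U - L \<le> 2 * real N * g 0 / (real N)\<^sup>2"
    unfolding p0 U_def L_def grid_mean_def diff_divide_distrib[symmetric] by (rule divide_right_mono) simp
  then show "U - L \<le> 2 * g 0 / N"
    using \<open>N > 0\<close> by (simp add: power2_eq_square)
qed

text \<open>
  Squeezing between the step functions also gives the integrability of \<open>g\<close>, so that its Lebesgue integral
  agrees with the gauge integral.
\<close>

lemma riemann_sums_tendsto_square_integral:
  fixes g :: "real^2 \<Rightarrow> real"
  assumes nonneg: "\<And>x. x \<in> {0..1} \<Longrightarrow> 0 \<le> g x" and anti: "antimono_on {0..1} g"
  shows "(\<lambda>N. grid_mean (Suc N) (\<lambda>z. g (grid_point (Suc N) (next_cell z)))) \<longlonglongrightarrow> square_integral g"
proof -
  let ?L = "\<lambda>N. grid_mean (Suc N) (\<lambda>z. g (grid_point (Suc N) (next_cell z)))"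
  let ?U = "\<lambda>N. grid_mean (Suc N) (\<lambda>z. g (grid_point (Suc N) z))"
  have bounds: "\<exists>l u. (l has_integral ?L N) {0..1} \<and> (u has_integral ?U N) {0..1}
      \<and> (\<forall>x\<in>{0..1}. l x \<le> g x \<and> g x \<le> u x)" "?U N - ?L N \<le> 2 * g 0 / Suc N" for N
    using riemann_bounds[OF _ nonneg anti, of "Suc N"] by auto
  have null: "(\<lambda>N. 2 * g 0 / Suc N) \<longlonglongrightarrow> 0"
    by (rule LIMSEQ_Suc) (rule lim_const_over_n)
  have LU: "?L N \<le> ?U N" for N
  proof -
    obtain l u where lu: "(l has_integral ?L N) {0..1}" "(u has_integral ?U N) {0..1}"
      "\<And>x. x \<in> {0..1} \<Longrightarrow> l x \<le> g x \<and> g x \<le> u x"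
      using bounds(1)[of N] by blast
    show ?thesis
      by (rule has_integral_le[OF lu(1,2)]) (use lu(3) in \<open>blast intro: order_trans\<close>)
  qed
  have int: "g integrable_on {0..1}"
  proof (rule integrable_straddle)
    fix e :: real assume "e > 0"
    then obtain N where "2 * g 0 / Suc N < e"
      using null by (metis (mono_tags, lifting) eventually_sequentially le_refl order_tendstoD(2))
    then have "\<bar>?L N - ?U N\<bar> < e"
      using bounds(2)[of N] LU[of N] by linarith
    then show "\<exists>l u i j. (l has_integral i) {0..1} \<and> (u has_integral j) {0..1} \<and> \<bar>i - j\<bar> < e
        \<and> (\<forall>x\<in>{0..1}. l x \<le> g x \<and> g x \<le> u x)"
      using bounds(1)[of N] by blast
  qed
  then have "g absolutely_integrable_on {0..1}"
    using nonneg by (intro nonnegative_absolutely_integrable_1) auto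
  then have "integrable (lebesgue_on {0..1}) g"
    by (intro absolutely_integrable_imp_integrable) (auto simp: unit_square_cbox)
  then have eq: "square_integral g = integral {0..1} g"
    unfolding square_integral_def by (intro lebesgue_integral_eq_integral) (auto simp: unit_square_cbox)
  have "\<bar>?L N - integral {0..1} g\<bar> \<le> 2 * g 0 / Suc N" for N
  proof -
    obtain l u where lu: "(l has_integral ?L N) {0..1}" "(u has_integral ?U N) {0..1}"
      "\<And>x. x \<in> {0..1} \<Longrightarrow> l x \<le> g x" "\<And>x. x \<in> {0..1} \<Longrightarrow> g x \<le> u x"
      using bounds(1)[of N] by blast
    have "?L N \<le> integral {0..1} g"
      by (rule has_integral_le[OF lu(1) integrable_integral[OF int] lu(3)])
    moreover have "integral {0..1} g \<le> ?U N"
      by (rule has_integral_le[OF integrable_integral[OF int] lu(2) lu(4)])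
    ultimately show ?thesis
      using bounds(2)[of N] by linarith
  qed
  then have "(\<lambda>N. ?L N - integral {0..1} g) \<longlonglongrightarrow> 0"
    unfolding real_norm_def[symmetric] by (intro Lim_null_comparison[OF always_eventually null] allI)
  then show ?thesis
    unfolding eq by (rule LIM_zero_cancel)
qed

section \<open>The inequality on the unit square\<close>

lemma E_corr_eq_signed_cycle_sum:
  assumes "n \<ge> 1"
  shows "E_corr n f = - signed_cycle_sum square_integral {1..n} f"
proof -
  have "(- 1) ^ (num_cycles n \<sigma> - 1) * E_perm n \<sigma> f
      = - (\<Prod>c\<in>orbit \<sigma> ` {1..n}. - square_integral (\<lambda>x. \<Prod>i\<in>c. f i x))" for \<sigma>
  proof -
    have "num_cycles n \<sigma> > 0"
      using assms by (auto simp: num_cycles_def cycle_sets_def card_gt_0_iff)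
    then have "(- 1 :: real) ^ (num_cycles n \<sigma> - 1) = - ((- 1) ^ num_cycles n \<sigma>)"
      by (cases "num_cycles n \<sigma>") auto
    moreover have "(\<Prod>c\<in>cycle_sets n \<sigma>. - square_integral (\<lambda>x. \<Prod>i\<in>c. f i x)) = (- 1) ^ num_cycles n \<sigma> * E_perm n \<sigma> f"
      unfolding E_perm_def num_cycles_def by (rule prod_uminus)
    ultimately show ?thesis
      by (simp add: cycle_sets_def)
  qed
  then show ?thesis
    unfolding E_corr_def signed_cycle_sum_def sum_negf[symmetric] by (intro sum.cong refl)
qed

theorem theorem3p7:
  fixes n :: nat and f :: "nat \<Rightarrow> real^2 \<Rightarrow> real"
  assumes "n \<ge> 1"
    and "\<And>i x. i \<in> {1..n} \<Longrightarrow> x \<in> {0..1} \<Longrightarrow> 0 \<le> f i x"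
    and "\<And>i. i \<in> {1..n} \<Longrightarrow> antimono_on {0..1} (f i)"
  shows "E_corr n f \<ge> 0"
proof -
  let ?S = "{1..n}"
  let ?F = "\<lambda>N i z. f i (grid_point (Suc N) (next_cell z))"
  have "(\<lambda>N. signed_cycle_sum (grid_mean (Suc N)) ?S (?F N)) \<longlonglongrightarrow> signed_cycle_sum square_integral ?S f"
    unfolding signed_cycle_sum_def
  proof (intro tendsto_sum tendsto_prod tendsto_minus)
    fix \<sigma> c assume "\<sigma> \<in> {\<sigma>. \<sigma> permutes ?S}" "c \<in> orbit \<sigma> ` ?S"
    then have c: "c \<subseteq> ?S"
      using permutes_orbit_subset by fastforce
    show "(\<lambda>N. grid_mean (Suc N) (\<lambda>z. \<Prod>i\<in>c. ?F N i z)) \<longlonglongrightarrow> square_integral (\<lambda>x. \<Prod>i\<in>c. f i x)"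
    proof (rule riemann_sums_tendsto_square_integral)
      show "0 \<le> (\<Prod>i\<in>c. f i x)" if "x \<in> {0..1}" for x
        using c assms(2) that by (intro prod_nonneg) auto
      have "f i y \<le> f i x" if "i \<in> c" "x \<in> {0..1}" "y \<in> {0..1}" "x \<le> y" for i x y
        using assms(3)[of i] c that unfolding monotone_on_def by blast
      then show "antimono_on {0..1} (\<lambda>x. \<Prod>i\<in>c. f i x)"
        unfolding monotone_on_def using c assms(2) by (auto intro!: prod_mono)
    qed
  qed
  moreover have "signed_cycle_sum (grid_mean (Suc N)) ?S (?F N) \<le> 0" for N
  proof (rule signed_cycle_sum_grid_nonpos)
    fix i assume i: "i \<in> ?S"
    have sq: "grid_point (Suc N) (next_cell z) \<in> {0..1}" if "z \<in> {..<Suc N} \<times> {..<Suc N}" for z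
      using that by (intro grid_point_in_square) auto
    show "grid_antimono (Suc N) (?F N i)"
      unfolding grid_antimono_def
    proof (intro conjI allI impI ballI)
      show "0 \<le> ?F N i z" if "z \<in> {..<Suc N} \<times> {..<Suc N}" for z
        by (rule assms(2)[OF i sq[OF that]])
      show "?F N i (x, y) \<le> ?F N i (x', y')" if "x < Suc N" "y < Suc N" "x' \<le> x" "y' \<le> y" for x y x' y'
        using assms(3)[OF i] sq[of "(x, y)"] sq[of "(x', y')"] that
          grid_point_mono[of "next_cell (x', y')" "next_cell (x, y)" "Suc N"]
        unfolding monotone_on_def by auto
    qed
  qed (use assms(1) in auto)
  ultimately have "signed_cycle_sum square_integral ?S f \<le> 0"
    using LIMSEQ_le_const2 by blast
  then show ?thesis
    using E_corr_eq_signed_cycle_sum[OF assms(1)] by simp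
qed

end
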